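(* Let $f:\mathbb{R}^2\to\mathbb{R}$ be a real-valued function that is (Lebesgue) integrable on $\mathbb{R}^2$. Let $R(t,\theta)$ be its Radon transform, let $F(u,v)$ be its two-dimensional Fourier transform, and let $D(u,v)$ be its direct integration function (all as defined in the context), where the angle $\theta_0\in[0,\pi)$ used in the definition of $D(0,0)$ is arbitrary. Then $$D(u,v)=F(u,v)\qquad\text{for all }(u,v)\in\mathbb{R}^2 .$$
   Context: For $f:\mathbb{R}^2\to\mathbb{R}$ integrable, the Radon transform of $f$ is $$R(t,\theta)=\int_{-\infty}^{\infty} f\bigl(t\cos\theta-z\sin\theta,\;t\sin\theta+z\cos\theta\bigr)\,dz ,\qquad t\in\mathbb{R},\ \theta\in[0,\pi);$$ for each fixed $\theta$ this is defined for almost every $t$ and is an integrable function of $t$. The two-dimensional Fourier transform of $f$ is $$F(u,v)=\int_{-\infty}^{\infty}\int_{-\infty}^{\infty} f(x,y)\,e^{-i(ux+vy)}\,dx\,dy,\qquad (u,v)\in\mathbb{R}^2 .$$ For $(u,v)\neq(0,0)$, $\operatorname{atan2}(v,u)$ denotes the angle $\theta\in(-\pi,\pi]$ with $u=\sqrt{u^2+v^2}\cos\theta$ and $v=\sqrt{u^2+v^2}\sin\theta$; it lies in $[0,\pi)$ whenever $v>0$ or ($v=0$ and $u>0$). Fix an arbitrary $\theta_0\in[0,\pi)$. The direct integration function $D:\mathbb{R}^2\to\mathbb{C}$ is defined by $$D(u,v)=\begin{cases}\displaystyle\int_{-\infty}^{\infty}R\bigl(t,\operatorname{atan2}(v,u)\bigr)\,e^{-i\sqrt{u^2+v^2}\,t}\,dt,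 & \text{if } v>0 \text{ or } (v=0 \text{ and } u>0),\\[2ex] \displaystyle\int_{-\infty}^{\infty}R(t,\theta_0)\,dt, & \text{if } u=0 \text{ and } v=0,\\[2ex] \overline{D(-u,-v)}, & \text{otherwise,}\end{cases}$$ where the bar denotes complex conjugation (in the third case $(-u,-v)$ falls under the first case). *)

theory Defs
  imports "HOL-Analysis.Analysis"
begin

(* All integrals are Bochner integrals with respect to the completed Lebesgue measure.
   They take the value 0 where the integrand is not integrable; for integrable f this
   affects the inner integrals below only on null sets of the outer variable. *)

definition radon_transform :: "(real \<times> real \<Rightarrow> real) \<Rightarrow> real \<Rightarrow> real \<Rightarrow> real" where
  "radon_transform f t \<theta> =
     (LINT z|lebesgue. f (t * cos \<theta> - z * sin \<theta>, t * sin \<theta> + z * cos \<theta>))"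

definition fourier_transform_2d :: "(real \<times> real \<Rightarrow> real) \<Rightarrow> real \<Rightarrow> real \<Rightarrow> complex" where
  "fourier_transform_2d f u v =
     (LINT y|lebesgue. (LINT x|lebesgue.
        complex_of_real (f (x, y)) * exp (- (\<i> * complex_of_real (u * x + v * y)))))"

definition atan2 :: "real \<Rightarrow> real \<Rightarrow> real" where
  "atan2 v u = Arg (Complex u v)"

lemma atan2_bounds: "- pi < atan2 v u \<and> atan2 v u \<le> pi"
  unfolding atan2_def by (rule Arg_bounded)

lemma atan2_polar:
  "u = sqrt (u\<^sup>2 + v\<^sup>2) * cos (atan2 v u)"
  "v = sqrt (u\<^sup>2 + v\<^sup>2) * sin (atan2 v u)"
proof -
  have "Complex u v = rcis (sqrt (u\<^sup>2 + v\<^sup>2)) (atan2 v u)"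
    using rcis_cmod_Arg[of "Complex u v"] by (simp add: atan2_def complex_norm)
  then show "u = sqrt (u\<^sup>2 + v\<^sup>2) * cos (atan2 v u)"
    and "v = sqrt (u\<^sup>2 + v\<^sup>2) * sin (atan2 v u)"
    by (metis Re_rcis complex.sel(1), metis Im_rcis complex.sel(2) \<open>Complex u v = _\<close>)
qed

function direct_integration ::
  "(real \<times> real \<Rightarrow> real) \<Rightarrow> real \<Rightarrow> real \<Rightarrow> real \<Rightarrow> complex" where
  "direct_integration f \<theta>0 u v =
     (if v > 0 \<or> (v = 0 \<and> u > 0) then
        (LINT t|lebesgue. complex_of_real (radon_transform f t (atan2 v u)) *
           exp (- (\<i> * complex_of_real (sqrt (u\<^sup>2 + v\<^sup>2) * t))))
      else if u = 0 \<and> v = 0 then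
        complex_of_real (LINT t|lebesgue. radon_transform f t \<theta>0)
      else cnj (direct_integration f \<theta>0 (- u) (- v)))"
  by auto
termination
  by (relation "Wellfounded.measure (\<lambda>(f, \<theta>0, u, v). if v > 0 \<or> (v = 0 \<and> u > 0) then 0 else 1)") auto

(* The recursive equation has no guard on its left-hand side and would loop in the simplifier. *)
declare direct_integration.simps [simp del]

end

theory Submission
  imports Defs
begin

text \<open>Rotating the plane by the angle of the frequency vector turns the phase ux + vy into rt, so that
  the one-dimensional Fourier transform of the Radon transform becomes an iterated integral of the
  rotated two-dimensional integrand. Fubini's theorem in both orders and the invariance of Lebesgue
  measure under rotations give the claim on the upper half-plane and at the origin; conjugate
  symmetry of the Fourier transform of a real function gives the rest. Since sections of Lebesgue
  measurable functions need not be measurable, Fubini is applied to a Borel function that agrees with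
  the integrand almost everywhere.\<close>

text \<open>Bridges Lebesgue and Borel integrals: in the completion, \<open>f\<close> inherits
  measurability from \<open>g\<close>, because the two differ only on a null set.\<close>

lemma integral_completion_cong_AE:
  fixes f g :: "'a \<Rightarrow> 'b::{banach, second_countable_topology}"
  assumes [measurable]: "g \<in> borel_measurable M" and eq: "AE x in M. f x = g x"
  shows "integral\<^sup>L (completion M) f = integral\<^sup>L M g"
proof -
  have g: "g \<in> borel_measurable (completion M)"
    by (simp add: measurable_completion)
  have "f \<in> borel_measurable (completion M)"
  proof (rule measurableI)
    fix A :: "'b set" assume A: "A \<in> sets borel"
    have gA: "g -` A \<inter> space (completion M) \<in> sets (completion M)"
      using g A by (rule measurable_sets)
    \<comment> \<open>The preimages of \<open>A\<close> under \<open>f\<close> and \<open>g\<close>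
      agree up to a null set, and in a complete measure space this passes measurability from one to
      the other.\<close>
    have "AE x in completion M. x \<in> g -` A \<inter> space M \<longleftrightarrow> x \<in> f -` A \<inter> space M"
      using AE_completion[OF eq] by eventually_elim auto
    then show "f -` A \<inter> space (completion M) \<in> sets (completion M)"
      unfolding space_completion
      by (rule completion.in_sets_AE) (use gA in simp_all)
  qed simp
  then have "integral\<^sup>L (completion M) f = integral\<^sup>L (completion M) g"
    using g AE_completion[OF eq] by (rule integral_cong_AE)
  then show ?thesis by (simp add: integral_completion)
qed

text \<open>For almost every value of the outer variable, the sections of \<open>f\<close> and
  \<open>g\<close> agree almost everywhere, so the inner integrals coincide; the exceptional values
  do not affect the outer integral. Fubini for \<open>g\<close> does the rest. Order (1) serves the
  Radon side, order (2) matches \<open>fourier_transform_2d\<close>.\<close>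

lemma iterated_integral_lebesgue:
  fixes f g :: "'a::euclidean_space \<times> 'b::euclidean_space \<Rightarrow> 'c::{banach, second_countable_topology}"
  assumes g: "integrable lborel g" and eq: "AE p in lborel. f p = g p"
  shows "(LINT x|lebesgue. LINT y|lebesgue. f (x, y)) = integral\<^sup>L lborel g"
    and "(LINT y|lebesgue. LINT x|lebesgue. f (x, y)) = integral\<^sup>L lborel g"
proof -
  have int: "integrable (lborel \<Otimes>\<^sub>M lborel) g" and eq2: "AE p in lborel \<Otimes>\<^sub>M lborel. f p = g p"
    using g eq unfolding lborel_prod by simp_all
  have [measurable]: "g \<in> borel_measurable (lborel \<Otimes>\<^sub>M lborel)"
    using int by simp
  have "AE x in lborel. (LINT y|lebesgue. f (x, y)) = (LINT y|lborel. g (x, y))"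
    using lborel_pair.AE_pair[OF eq2] by eventually_elim (rule integral_completion_cong_AE, auto)
  then have "(LINT x|lebesgue. LINT y|lebesgue. f (x, y)) = (LINT x|lborel. LINT y|lborel. g (x, y))"
    by (rule integral_completion_cong_AE[rotated]) simp
  also have "\<dots> = integral\<^sup>L lborel g"
    using lborel_pair.integral_fst'[OF int] by (simp add: lborel_prod)
  finally show "(LINT x|lebesgue. LINT y|lebesgue. f (x, y)) = integral\<^sup>L lborel g" .
  \<comment> \<open>\<open>AE_pair\<close> quantifies over the first coordinate outside. For the
    other order the statement is pulled back along the coordinate swap, which preserves the product
    measure.\<close>
  have "AE p in distr (lborel \<Otimes>\<^sub>M lborel) (lborel \<Otimes>\<^sub>M lborel) (\<lambda>(y, x). (x, y)). f p = g p"
    using eq2 unfolding lborel_pair.distr_pair_swap[symmetric] .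
  from lborel_pair.AE_pair[OF AE_distrD[OF measurable_pair_swap' this]]
  have "AE y in lborel. AE x in lborel. f (x, y) = g (x, y)"
    by simp
  then have "AE y in lborel. (LINT x|lebesgue. f (x, y)) = (LINT x|lborel. g (x, y))"
    by eventually_elim (rule integral_completion_cong_AE, auto)
  then have "(LINT y|lebesgue. LINT x|lebesgue. f (x, y)) = (LINT y|lborel. LINT x|lborel. g (x, y))"
    by (rule integral_completion_cong_AE[rotated]) simp
  also have "\<dots> = integral\<^sup>L lborel g"
    using lborel_pair.integral_snd[of "\<lambda>x y. g (x, y)"] int by (simp add: lborel_prod)
  finally show "(LINT y|lebesgue. LINT x|lebesgue. f (x, y)) = integral\<^sup>L lborel g" .
qed

text \<open>By Tonelli with \<open>y\<close> outside: on each horizontal line the shear is the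
  translation by \<open>c * y\<close>, which preserves one-dimensional Lebesgue measure.\<close>

lemma distr_lborel_shear_fst:
  "distr lborel lborel (\<lambda>(x, y). (x + c * y, y)) = (lborel :: (real \<times> real) measure)"
  (is "distr _ _ ?T = _")
proof (rule measure_eqI)
  have [measurable]: "?T \<in> borel_measurable borel"
    unfolding case_prod_beta by (intro borel_measurable_continuous_onI continuous_intros)
  fix A assume "A \<in> sets (distr lborel lborel ?T)"
  then have A: "A \<in> sets borel" by simp
  have A'[measurable]: "A \<in> sets (borel \<Otimes>\<^sub>M borel)" using A unfolding borel_prod .
  have "emeasure (distr lborel lborel ?T) A = (\<integral>\<^sup>+ p. indicator A p \<partial>distr lborel lborel ?T)"
    using A by simp
  also have "\<dots> = (\<integral>\<^sup>+ p. indicator A (?T p) \<partial>(lborel \<Otimes>\<^sub>M lborel))"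
    using A by (subst nn_integral_distr) (simp_all add: lborel_prod)
  also have "\<dots> = (\<integral>\<^sup>+ y. \<integral>\<^sup>+ x. indicator A (x + c * y, y) \<partial>lborel \<partial>lborel)"
    by (subst lborel_pair.nn_integral_snd[symmetric]) (simp_all add: case_prod_beta)
  also have "\<dots> = (\<integral>\<^sup>+ y. \<integral>\<^sup>+ x. indicator A (x, y) \<partial>lborel \<partial>lborel)"
  proof (rule nn_integral_cong)
    fix y :: real
    show "(\<integral>\<^sup>+ x. indicator A (x + c * y, y) \<partial>lborel) = (\<integral>\<^sup>+ x. indicator A (x, y) \<partial>lborel)"
      using nn_integral_real_affine[of "\<lambda>x. indicator A (x, y)" 1 "c * y"] by (simp add: add.commute)
  qed
  also have "\<dots> = (\<integral>\<^sup>+ p. indicator A p \<partial>(lborel \<Otimes>\<^sub>M lborel))"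
    by (subst lborel_pair.nn_integral_snd[symmetric]) (simp_all add: case_prod_beta)
  also have "\<dots> = emeasure lborel A"
    using A by (simp add: lborel_prod)
  finally show "emeasure (distr lborel lborel ?T) A = emeasure lborel A" .
qed simp

text \<open>The same argument on vertical lines, hence with \<open>x\<close> outside.\<close>

lemma distr_lborel_shear_snd:
  "distr lborel lborel (\<lambda>(x, y). (x, y + c * x)) = (lborel :: (real \<times> real) measure)"
  (is "distr _ _ ?T = _")
proof (rule measure_eqI)
  have [measurable]: "?T \<in> borel_measurable borel"
    unfolding case_prod_beta by (intro borel_measurable_continuous_onI continuous_intros)
  fix A assume "A \<in> sets (distr lborel lborel ?T)"
  then have A: "A \<in> sets borel" by simp
  have A'[measurable]: "A \<in> sets (borel \<Otimes>\<^sub>M borel)" using A unfolding borel_prod .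
  have "emeasure (distr lborel lborel ?T) A = (\<integral>\<^sup>+ p. indicator A p \<partial>distr lborel lborel ?T)"
    using A by simp
  also have "\<dots> = (\<integral>\<^sup>+ p. indicator A (?T p) \<partial>(lborel \<Otimes>\<^sub>M lborel))"
    using A by (subst nn_integral_distr) (simp_all add: lborel_prod)
  also have "\<dots> = (\<integral>\<^sup>+ x. \<integral>\<^sup>+ y. indicator A (x, y + c * x) \<partial>lborel \<partial>lborel)"
    by (subst lborel.nn_integral_fst[symmetric]) (simp_all add: case_prod_beta)
  also have "\<dots> = (\<integral>\<^sup>+ x. \<integral>\<^sup>+ y. indicator A (x, y) \<partial>lborel \<partial>lborel)"
  proof (rule nn_integral_cong)
    fix x :: real
    show "(\<integral>\<^sup>+ y. indicator A (x, y + c * x) \<partial>lborel) = (\<integral>\<^sup>+ y. indicator A (x, y) \<partial>lborel)"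
      using nn_integral_real_affine[of "\<lambda>y. indicator A (x, y)" 1 "c * x"] by (simp add: add.commute)
  qed
  also have "\<dots> = (\<integral>\<^sup>+ p. indicator A p \<partial>(lborel \<Otimes>\<^sub>M lborel))"
    by (subst lborel.nn_integral_fst[symmetric]) (simp_all add: case_prod_beta)
  also have "\<dots> = emeasure lborel A"
    using A by (simp add: lborel_prod)
  finally show "emeasure (distr lborel lborel ?T) A = emeasure lborel A" .
qed simp

text \<open>A rotation is a composition of three shears S U S, with S horizontal and U vertical; only the
  rotation by an odd multiple of pi is missed.\<close>

lemma distr_lborel_rotation:
  assumes "cos (\<theta> / 2) \<noteq> 0"
  shows "distr lborel lborel (\<lambda>(x, y). (x * cos \<theta> - y * sin \<theta>, x * sin \<theta> + y * cos \<theta>))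
    = (lborel :: (real \<times> real) measure)"
proof -
  \<comment> \<open>The diagonal entries of S U S are \<open>1 + c * sin \<theta>\<close>, which
    must equal \<open>cos \<theta>\<close>. The half-angle form of the solution also covers \<theta>
    = 0, where solving for \<open>c\<close> would divide by zero.\<close>
  define c where "c = - tan (\<theta> / 2)"
  define S where "S = (\<lambda>(x, y). (x + c * y, y))"
  define U where "U = (\<lambda>(x, y). (x, y + sin \<theta> * x))"
  have [measurable]: "S \<in> borel_measurable borel" "U \<in> borel_measurable borel"
    unfolding S_def U_def case_prod_beta
    by (intro borel_measurable_continuous_onI continuous_intros)+
  have s: "sin \<theta> = 2 * sin (\<theta> / 2) * cos (\<theta> / 2)" and co: "cos \<theta> = 1 - 2 * (sin (\<theta> / 2))\<^sup>2"
    using sin_double[of "\<theta> / 2"] cos_double_sin[of "\<theta> / 2"] by simp_all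
  \<comment> \<open>\<open>c1\<close> is the diagonal of the product and \<open>c2\<close> its upper
    right entry; the lower left one is already \<open>sin \<theta>\<close>.\<close>
  have c1: "1 + c * sin \<theta> = cos \<theta>"
    using assms by (simp add: c_def tan_def s co power2_eq_square)
  have "c * (1 + cos \<theta>) = - sin \<theta>"
    using assms cos_double_cos[of "\<theta> / 2"] by (simp add: c_def tan_def s power2_eq_square)
  then have c2: "c + c * cos \<theta> = - sin \<theta>" by (simp add: algebra_simps)
  have rot: "(\<lambda>(x, y). (x * cos \<theta> - y * sin \<theta>, x * sin \<theta> + y * cos \<theta>)) = S \<circ> (U \<circ> S)"
  proof (clarsimp simp: fun_eq_iff S_def U_def)
    fix x y
    have "x + c * y + c * (y + sin \<theta> * (x + c * y))
      = x * (1 + c * sin \<theta>) + y * (c + c * (1 + c * sin \<theta>))" by (simp add: algebra_simps)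
    moreover have "y + sin \<theta> * (x + c * y) = x * sin \<theta> + y * (1 + c * sin \<theta>)" by (simp add: algebra_simps)
    ultimately show "x * cos \<theta> - y * sin \<theta> = x + c * y + c * (y + sin \<theta> * (x + c * y))
      \<and> x * sin \<theta> + y * cos \<theta> = y + sin \<theta> * (x + c * y)"
      unfolding c1 c2 by simp
  qed
  have "distr lborel lborel (S \<circ> (U \<circ> S)) = distr (distr (distr lborel lborel S) lborel U) lborel S"
    by (subst distr_distr, simp, simp, subst distr_distr) (simp_all add: comp_assoc)
  also have "\<dots> = lborel"
    unfolding S_def U_def distr_lborel_shear_fst distr_lborel_shear_snd ..
  finally show ?thesis unfolding rot .
qed

text \<open>The projection-slice theorem for a fixed direction. The radius \<open>r\<close> may be
  any real; \<open>r = 0\<close> is the case used at the origin.\<close>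

lemma fourier_radon_transform:
  fixes f :: "real \<times> real \<Rightarrow> real"
  assumes f: "integrable lebesgue f" and \<theta>: "cos (\<theta> / 2) \<noteq> 0"
  shows "(LINT t|lebesgue. complex_of_real (radon_transform f t \<theta>) * exp (- (\<i> * complex_of_real (r * t))))
    = fourier_transform_2d f (r * cos \<theta>) (r * sin \<theta>)"
proof -
  obtain g where [measurable]: "g \<in> borel_measurable lborel" and fg: "AE p in lborel. f p = g p"
    using completion_ex_borel_measurable_real[OF borel_measurable_integrable[OF f]] by blast
  have "integrable lebesgue g"
    using f by (rule integrable_cong_AE_imp) (auto simp: measurable_completion AE_completion fg eq_commute)
  then have g: "integrable lborel g"
    by (simp add: integrable_completion)
  define E where "E = (\<lambda>(x, y). exp (- (\<i> * complex_of_real (r * cos \<theta> * x + r * sin \<theta> * y))))"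
  define T where "T = (\<lambda>(t, z). (t * cos \<theta> - z * sin \<theta>, t * sin \<theta> + z * cos \<theta>))"
  define k where "k = (\<lambda>p. complex_of_real (g p) * E p)"
  have [measurable]: "T \<in> borel_measurable borel" "E \<in> borel_measurable borel"
    unfolding T_def E_def case_prod_beta
    by (intro borel_measurable_continuous_onI continuous_intros)+
  have distr_T: "distr lborel lborel T = lborel"
    unfolding T_def by (rule distr_lborel_rotation[OF \<theta>])
  \<comment> \<open>The phase factor has modulus 1, so \<open>k\<close> is integrable along with
    \<open>g\<close>.\<close>
  have "norm (E p) = 1" for p
    by (cases p) (simp add: E_def)
  then have k: "integrable lborel k"
    unfolding k_def
    by (intro Bochner_Integration.integrable_bound[OF g]) (simp_all add: norm_mult)
  then have kT: "integrable lborel (\<lambda>p. k (T p))"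
    by (subst integrable_distr_eq[symmetric, of T lborel lborel]) (simp_all add: distr_T)
  \<comment> \<open>\<open>T\<close> preserves the measure, so the preimage of the exceptional null
    set is again null.\<close>
  have eqT: "AE p in lborel. f (T p) = g (T p)"
    using fg by (subst (asm) distr_T[symmetric]) (rule AE_distrD[rotated], auto)
  \<comment> \<open>In rotated coordinates the phase does not depend on \<open>z\<close>, so the
    exponential can move inside the integral over \<open>z\<close>.\<close>
  have ET: "E (T (t, z)) = exp (- (\<i> * complex_of_real (r * t)))" for t z
  proof -
    have "r * cos \<theta> * (t * cos \<theta> - z * sin \<theta>) + r * sin \<theta> * (t * sin \<theta> + z * cos \<theta>)
      = r * t * (sin \<theta> * sin \<theta> + cos \<theta> * cos \<theta>)" by algebra
    also have "\<dots> = r * t" by (simp flip: power2_eq_square)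
    finally show ?thesis unfolding E_def T_def prod.case by (simp only:)
  qed
  \<comment> \<open>This holds for every \<open>t\<close>: where the section is not integrable, both
    sides are 0 by the default value of the integral.\<close>
  have "complex_of_real (radon_transform f t \<theta>) * exp (- (\<i> * complex_of_real (r * t)))
      = (LINT z|lebesgue. complex_of_real (f (T (t, z))) * E (T (t, z)))" for t
    unfolding ET by (simp add: radon_transform_def T_def)
  then have "(LINT t|lebesgue. complex_of_real (radon_transform f t \<theta>) * exp (- (\<i> * complex_of_real (r * t))))
    = (LINT t|lebesgue. LINT z|lebesgue. complex_of_real (f (T (t, z))) * E (T (t, z)))"
    by simp
  also have "\<dots> = (LINT p|lborel. k (T p))"
    by (rule iterated_integral_lebesgue(1)[OF kT, of "\<lambda>p. complex_of_real (f (T p)) * E (T p)"]) (use eqT in \<open>auto simp: k_def\<close>)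
  also have "\<dots> = integral\<^sup>L lborel k"
    using k by (subst (2) distr_T[symmetric], subst integral_distr) simp_all
  also have "\<dots> = (LINT y|lebesgue. LINT x|lebesgue. complex_of_real (f (x, y)) * E (x, y))"
    by (rule iterated_integral_lebesgue(2)[OF k, of "\<lambda>p. complex_of_real (f p) * E p", symmetric]) (use fg in \<open>auto simp: k_def\<close>)
  also have "\<dots> = fourier_transform_2d f (r * cos \<theta>) (r * sin \<theta>)"
    by (simp add: fourier_transform_2d_def E_def)
  finally show ?thesis .
qed

text \<open>Since \<open>f\<close> is real, conjugating the integrand only flips the sign of the
  phase.\<close>

lemma fourier_transform_2d_minus:
  "cnj (fourier_transform_2d f (- u) (- v)) = fourier_transform_2d f u v"
proof -
  have "cnj (complex_of_real (f (x, y)) * exp (- (\<i> * complex_of_real (- u * x + - v * y))))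
      = complex_of_real (f (x, y)) * exp (- (\<i> * complex_of_real (u * x + v * y)))" for x y
    by (simp only: complex_cnj_mult complex_cnj_complex_of_real exp_cnj
        complex_cnj_minus complex_cnj_i) (simp add: algebra_simps)
  then show ?thesis
    by (simp only: fourier_transform_2d_def Bochner_Integration.integral_cnj[symmetric])
qed

lemma direct_integration_upper:
  assumes f: "integrable lebesgue f" and uv: "v > 0 \<or> (v = 0 \<and> u > 0)"
  shows "direct_integration f \<theta>0 u v = fourier_transform_2d f u v"
proof -
  define \<theta> where "\<theta> = atan2 v u"
  \<comment> \<open>The angle pi belongs to the negative \<open>u\<close>-axis, which
    \<open>uv\<close> excludes. In the range of \<open>atan2\<close> it is the only angle with
    \<open>cos (\<theta> / 2) = 0\<close>.\<close>
  have "\<theta> \<noteq> pi"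
  proof
    assume "\<theta> = pi"
    then have "v = 0" "u = - sqrt (u\<^sup>2 + v\<^sup>2)"
      using atan2_polar(1)[of u v] atan2_polar(2)[of v u] by (simp_all add: \<theta>_def)
    then show False
      using uv real_sqrt_ge_zero[of "u\<^sup>2 + v\<^sup>2"] by auto
  qed
  then have "cos (\<theta> / 2) > 0"
    using atan2_bounds[of v u] by (intro cos_gt_zero_pi) (auto simp: \<theta>_def)
  then show ?thesis
    using fourier_radon_transform[OF f, of \<theta> "sqrt (u\<^sup>2 + v\<^sup>2)"] uv
      atan2_polar(1)[of u v] atan2_polar(2)[of v u]
    by (subst direct_integration.simps) (simp add: \<theta>_def)
qed

theorem theorem1:
  fixes f :: "real \<times> real \<Rightarrow> real" and \<theta>0 :: real
  assumes "integrable lebesgue f"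
    and "0 \<le> \<theta>0" and "\<theta>0 < pi"
  shows "\<forall>u v. direct_integration f \<theta>0 u v = fourier_transform_2d f u v"
proof (intro allI)
  fix u v :: real
  consider "v > 0 \<or> (v = 0 \<and> u > 0)" | "u = 0" "v = 0" | "v < 0 \<or> (v = 0 \<and> u < 0)"
    by linarith
  then show "direct_integration f \<theta>0 u v = fourier_transform_2d f u v"
  proof cases
    case 1
    then show ?thesis by (rule direct_integration_upper[OF assms(1)])
  next
    case 2
    have "cos (\<theta>0 / 2) > 0"
      using assms by (intro cos_gt_zero_pi) auto
    \<comment> \<open>With radius 0 the exponential is 1 and the frequency is the origin, whatever
      the angle \<open>\<theta>0\<close>.\<close>
    then show ?thesis
      using fourier_radon_transform[OF assms(1), of \<theta>0 0] 2
      by (subst direct_integration.simps) simp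
  next
    case 3
    then have "direct_integration f \<theta>0 u v = cnj (direct_integration f \<theta>0 (- u) (- v))"
      by (subst direct_integration.simps) auto
    also have "direct_integration f \<theta>0 (- u) (- v) = fourier_transform_2d f (- u) (- v)"
      using 3 by (intro direct_integration_upper assms(1)) auto
    finally show ?thesis by (simp only: fourier_transform_2d_minus)
  qed
qed

end
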